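(* There is no randomized online algorithm for the discrete data-center optimization problem that achieves a competitive ratio less than $2$ against an oblivious adversary.
   Context: Discrete data-center optimization problem: given $T,m\in\mathbb{N}$, $\beta>0$ and convex functions $f_1,\dots,f_T:\{0,\dots,m\}\to\mathbb{R}_{\ge0}$, a schedule $X=(x_1,\dots,x_T)\in\{0,\dots,m\}^T$ with $x_0=0$ has cost $\sum_{t=1}^T f_t(x_t)+\beta\sum_{t=1}^T(x_t-x_{t-1})^+$, $(y)^+=\max(0,y)$. Online: at time $t$ the algorithm knows only $f_1,\dots,f_t$ and chooses $x_t$ irrevocably (possibly using randomness). A randomized online algorithm has competitive ratio $c$ against an oblivious adversary if for every instance (fixed in advance, independently of the algorithm's random choices) its expected cost is at most $c$ times the optimal offline cost. *)

theory Defs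
  imports "HOL-Probability.Probability"
begin

section \<open>The discrete data-center optimization problem\<close>

text \<open>
  Functions on \<open>{0..m}\<close> are extensional functions on \<open>nat\<close>, so that an operating cost function
  carries no information besides its values on \<open>{0..m}\<close>. Convexity on this discrete domain is the
  usual convexity inequality for all convex combinations that lie in the domain.
\<close>

definition convex_on_states :: "nat \<Rightarrow> (nat \<Rightarrow> real) \<Rightarrow> bool" where
  "convex_on_states m f \<longleftrightarrow>
     (\<forall>x\<in>{0..m}. \<forall>y\<in>{0..m}. \<forall>z\<in>{0..m}. \<forall>u::real. 0 \<le> u \<and> u \<le> 1 \<and>
        real z = (1 - u) * real x + u * real y \<longrightarrow> f z \<le> (1 - u) * f x + u * f y)"

definition cost_functions :: "nat \<Rightarrow> (nat \<Rightarrow> real) set" where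
  "cost_functions m = {f \<in> {0..m} \<rightarrow>\<^sub>E {0..}. convex_on_states m f}"

definition dc_instance :: "nat \<Rightarrow> nat \<Rightarrow> real \<Rightarrow> (nat \<Rightarrow> nat \<Rightarrow> real) \<Rightarrow> bool" where
  "dc_instance T m \<beta> f \<longleftrightarrow> \<beta> > 0 \<and> (\<forall>t\<in>{1..T}. f t \<in> cost_functions m)"

definition schedules :: "nat \<Rightarrow> nat \<Rightarrow> (nat \<Rightarrow> nat) set" where
  "schedules T m = {x \<in> {0..T} \<rightarrow>\<^sub>E {0..m}. x 0 = 0}"

definition schedule_cost :: "nat \<Rightarrow> real \<Rightarrow> (nat \<Rightarrow> nat \<Rightarrow> real) \<Rightarrow> (nat \<Rightarrow> nat) \<Rightarrow> real" where
  "schedule_cost T \<beta> f x =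
     (\<Sum>t=1..T. f t (x t)) + \<beta> * (\<Sum>t=1..T. max 0 (real (x t) - real (x (t - 1))))"

definition opt_cost :: "nat \<Rightarrow> nat \<Rightarrow> real \<Rightarrow> (nat \<Rightarrow> nat \<Rightarrow> real) \<Rightarrow> real" where
  "opt_cost T m \<beta> f = Min (schedule_cost T \<beta> f ` schedules T m)"

lemma finite_schedules: "finite (schedules T m)"
  unfolding schedules_def by (rule finite_subset[of _ "{0..T} \<rightarrow>\<^sub>E {0..m}"]) (auto intro: finite_PiE)

lemma schedules_nonempty: "schedules T m \<noteq> {}"
proof -
  have "(\<lambda>t\<in>{0..T}. 0) \<in> schedules T m"
    by (auto simp: schedules_def)
  then show ?thesis by blast
qed

section \<open>Randomized online algorithms\<close>

text \<open>
  \<open>A m \<beta> [f\<^sub>1, \<dots>, f\<^sub>t] \<omega>\<close> is the state chosen at time \<open>t\<close>, where \<open>\<omega>\<close> is the outcome of all random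
  choices of the algorithm, drawn from the probability space \<open>M\<close>. The algorithm knows the
  parameters \<open>m\<close> and \<open>\<beta>\<close>, but neither \<open>T\<close> nor any future function. Its earlier states are
  determined by the same prefix and \<open>\<omega>\<close>, so they need not be passed as arguments.
\<close>

type_synonym 'w online_alg = "nat \<Rightarrow> real \<Rightarrow> (nat \<Rightarrow> real) list \<Rightarrow> 'w \<Rightarrow> nat"

definition randomized_online_algorithm :: "'w measure \<Rightarrow> 'w online_alg \<Rightarrow> bool" where
  "randomized_online_algorithm M A \<longleftrightarrow> prob_space M \<and>
     (\<forall>m \<beta> fs. \<beta> > 0 \<and> fs \<noteq> [] \<and> set fs \<subseteq> cost_functions m \<longrightarrow>
        A m \<beta> fs \<in> M \<rightarrow>\<^sub>M count_space {0..m})"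

definition alg_schedule ::
    "'w online_alg \<Rightarrow> nat \<Rightarrow> real \<Rightarrow> (nat \<Rightarrow> nat \<Rightarrow> real) \<Rightarrow> 'w \<Rightarrow> nat \<Rightarrow> nat" where
  "alg_schedule A m \<beta> f \<omega> t = (if t = 0 then 0 else A m \<beta> (map f [1..<Suc t]) \<omega>)"

text \<open>
  Obliviousness: the instance is quantified outside the expectation, so it may depend on \<open>A\<close> and
  \<open>M\<close> but not on \<open>\<omega>\<close>. On an instance, the integrand is bounded and measurable.
\<close>

definition expected_cost ::
    "'w measure \<Rightarrow> 'w online_alg \<Rightarrow> nat \<Rightarrow> nat \<Rightarrow> real \<Rightarrow> (nat \<Rightarrow> nat \<Rightarrow> real) \<Rightarrow> real" where
  "expected_cost M A T m \<beta> f = (\<integral>\<omega>. schedule_cost T \<beta> f (alg_schedule A m \<beta> f \<omega>) \<partial>M)"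

definition has_competitive_ratio :: "'w measure \<Rightarrow> 'w online_alg \<Rightarrow> real \<Rightarrow> bool" where
  "has_competitive_ratio M A c \<longleftrightarrow>
     (\<forall>T m \<beta> f. dc_instance T m \<beta> f \<longrightarrow> expected_cost M A T m \<beta> f \<le> c * opt_cost T m \<beta> f)"

end

theory Submission
  imports Defs
begin

text \<open>
  Two states and \<open>\<beta> = 1\<close> suffice. Only the probability \<open>p\<close> of being in state 1 matters, because the
  expected switching cost of a step is at least the increase of \<open>p\<close>. Every task charges
  \<open>e = 1/n\<close> in one of the two states. The adversary tracks an integer \<open>k\<close> between 0 and \<open>n\<close>
  such that the cheapest schedule ending in state 1 costs \<open>1 - k e\<close> more than the
  cheapest one ending in state 0; a task charging state 0 increments \<open>k\<close>, and a task charging state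
  1 decrements it, both truncated at the ends. The optimum grows by \<open>e\<close> only when \<open>k\<close> is
  incremented. Following \<open>p = k e\<close> would cost twice the optimum up to a bounded term; the adversary
  charges state 0 if \<open>p\<close> lies below a line through \<open>(0, e)\<close> and \<open>(n, 1 - e)\<close> and charges state 1
  otherwise. A potential function shows that deviating from the line does not pay. As the line
  stays away from 0 and 1, each truncated step costs the algorithm at least \<open>e\<^sup>2\<close> and the optimum
  nothing, so either kind of step drives the ratio towards 2 in the long run.
\<close>

section \<open>Two-state instances\<close>

definition two_state_cost :: "real \<Rightarrow> real \<Rightarrow> nat \<Rightarrow> real" where
  "two_state_cost a b = (\<lambda>x\<in>{0..1}. if x = 0 then a else b)"

lemma two_state_cost_simps [simp]:
  "two_state_cost a b 0 = a" "two_state_cost a b (Suc 0) = b"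
  by (auto simp: two_state_cost_def)

text \<open>Affinity turns the convexity inequality into an equality.\<close>

lemma two_state_cost_affine:
  assumes "x \<in> {0..1::nat}"
  shows "two_state_cost a b x = a + (b - a) * real x"
proof -
  have "x = 0 \<or> x = 1" using assms by auto
  then show ?thesis by (auto simp: two_state_cost_def)
qed

lemma two_state_cost_in_cost_functions:
  assumes "a \<ge> 0" "b \<ge> 0"
  shows "two_state_cost a b \<in> cost_functions 1"
proof -
  have "convex_on_states 1 (two_state_cost a b)"
    unfolding convex_on_states_def
    by (auto simp: two_state_cost_affine simp del: atLeastAtMost_iff) (simp add: algebra_simps)
  then show ?thesis
    using assms by (auto simp: cost_functions_def two_state_cost_def)
qed

section \<open>Extending schedules by one step and bounding the optimum\<close>

lemma schedule_cost_0: "schedule_cost 0 \<beta> f x = 0"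
  by (simp add: schedule_cost_def)

lemma schedule_cost_Suc:
  "schedule_cost (Suc t) \<beta> f x = schedule_cost t \<beta> f x + f (Suc t) (x (Suc t))
     + \<beta> * max 0 (real (x (Suc t)) - real (x t))"
  by (simp add: schedule_cost_def algebra_simps)

lemma schedule_cost_cong:
  assumes "\<And>t. t \<le> T \<Longrightarrow> x t = y t"
  shows "schedule_cost T \<beta> f x = schedule_cost T \<beta> f y"
  unfolding schedule_cost_def using assms by (auto intro!: arg_cong2[of _ _ _ _ "(+)"] sum.cong)

lemma extend_schedule:
  assumes "x \<in> schedules t m" "r \<le> m"
  shows "x(Suc t := r) \<in> schedules (Suc t) m"
    and "schedule_cost (Suc t) \<beta> f (x(Suc t := r)) =
           schedule_cost t \<beta> f x + f (Suc t) r + \<beta> * max 0 (real r - real (x t))"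
proof -
  show "x(Suc t := r) \<in> schedules (Suc t) m"
    using assms by (auto simp: schedules_def PiE_iff extensional_def le_Suc_eq)
  have "schedule_cost t \<beta> f (x(Suc t := r)) = schedule_cost t \<beta> f x"
    by (rule schedule_cost_cong) auto
  then show "schedule_cost (Suc t) \<beta> f (x(Suc t := r)) =
           schedule_cost t \<beta> f x + f (Suc t) r + \<beta> * max 0 (real r - real (x t))"
    by (simp add: schedule_cost_Suc)
qed

lemma opt_cost_le: "x \<in> schedules T m \<Longrightarrow> opt_cost T m \<beta> f \<le> schedule_cost T \<beta> f x"
  unfolding opt_cost_def by (rule Min_le) (auto simp: finite_schedules)

lemma opt_cost_nonneg:
  assumes "dc_instance T m \<beta> f"
  shows "opt_cost T m \<beta> f \<ge> 0"
  unfolding opt_cost_def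
proof (rule Min.boundedI)
  fix v assume "v \<in> schedule_cost T \<beta> f ` schedules T m"
  then obtain x where x: "x \<in> schedules T m" and v: "v = schedule_cost T \<beta> f x" by auto
  have "f t (x t) \<ge> 0" if "t \<in> {1..T}" for t
  proof -
    have "f t \<in> {0..m} \<rightarrow>\<^sub>E {0..}" "x t \<in> {0..m}"
      using that assms x by (auto simp: dc_instance_def cost_functions_def schedules_def PiE_iff)
    then show ?thesis by (auto simp: PiE_iff)
  qed
  then show "0 \<le> v"
    using assms unfolding v schedule_cost_def dc_instance_def
    by (intro add_nonneg_nonneg sum_nonneg mult_nonneg_nonneg) auto
qed (auto simp: finite_schedules schedules_nonempty)

text \<open>
  \<open>w\<close> bounds the work function at time \<open>t\<close>. The switch from \<open>x t\<close> to \<open>s\<close> is charged separately so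
  that the bound already makes sense at time 0, where every schedule is in state 0.
\<close>

definition work_bound :: "nat \<Rightarrow> (nat \<Rightarrow> nat \<Rightarrow> real) \<Rightarrow> nat \<Rightarrow> real \<Rightarrow> bool" where
  "work_bound t f s w \<longleftrightarrow>
     (\<exists>x\<in>schedules t 1. schedule_cost t 1 f x + max 0 (real s - real (x t)) \<le> w)"

text \<open>Dynamic programming: serve the new task in state \<open>r\<close>. The switch to
  \<open>r\<close>, so far charged separately within \<open>w\<close>, becomes part of the schedule
  cost.\<close>

lemma work_bound_Suc:
  assumes "work_bound t f r w" "r \<le> 1"
    and "w + f (Suc t) r + max 0 (real s - real r) \<le> w'"
  shows "work_bound (Suc t) f s w'"
proof -
  obtain x where x: "x \<in> schedules t 1"
    "schedule_cost t 1 f x + max 0 (real r - real (x t)) \<le> w"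
    using assms(1) by (auto simp: work_bound_def)
  show ?thesis
    unfolding work_bound_def
    using extend_schedule(1)[OF x(1) assms(2)] extend_schedule(2)[OF x(1) assms(2), of 1 f]
      x(2) assms(3)
    by (intro bexI[of _ "x(Suc t := r)"]) auto
qed

lemma opt_cost_le_work_bound:
  assumes "work_bound t f 0 w"
  shows "opt_cost t 1 1 f \<le> w"
proof -
  obtain x where "x \<in> schedules t 1" "schedule_cost t 1 f x \<le> w"
    using assms by (auto simp: work_bound_def)
  then show ?thesis using opt_cost_le[of x t 1 1 f] by linarith
qed

section \<open>Potential function\<close>

definition threshold :: "real \<Rightarrow> nat \<Rightarrow> real" where
  "threshold e k = e + (1 - 2 * e) * (e * real k)"

text \<open>The term \<open>e * p\<close> moves the charge from the new probability to the old one,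
  which the adversary compared with the line; the factor \<open>1 - 2 * e\<close> keeps back
  \<open>2 * e\<close> per unit of upward movement to pay for this when state 0 is charged. The
  \<open>min\<close> term is the price of the gap still to be bought below the line. The sum is the
  part of \<open>e\<close> saved in each increment of \<open>k\<close> on the line, repaid when
  \<open>k\<close> drops.\<close>

definition potential :: "real \<Rightarrow> nat \<Rightarrow> real \<Rightarrow> real" where
  "potential e k p =
     e * p + (1 - 2 * e) * min 0 (p - threshold e k) - e * (\<Sum>j<k. threshold e j)"

lemma threshold_Suc: "threshold e (Suc k) = threshold e k + (1 - 2 * e) * e"
  by (simp add: threshold_def algebra_simps)

lemma threshold_bounds:
  assumes "0 \<le> e" "e \<le> 1 / 2" "e * real k \<le> 1"
  shows "e \<le> threshold e k" "threshold e k \<le> 1 - e"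
proof -
  show "e \<le> threshold e k" using assms by (simp add: threshold_def)
  have "(1 - 2 * e) * (e * real k) \<le> (1 - 2 * e) * 1"
    using assms by (intro mult_left_mono) auto
  then show "threshold e k \<le> 1 - e" by (simp add: threshold_def)
qed

text \<open>The truncation at 0 is monotone and 1-Lipschitz. Each step below first changes the
  counter at the old \<open>p\<close>, then moves \<open>p\<close> to \<open>q\<close>.\<close>

lemma potential_move:
  assumes "e \<le> 1 / 2"
  shows "potential e k q - potential e k p \<le> (1 - 2 * e) * max 0 (q - p) + e * (q - p)"
proof -
  have "(1 - 2 * e) * (min 0 (q - threshold e k) - min 0 (p - threshold e k))
          \<le> (1 - 2 * e) * max 0 (q - p)"
    using assms by (intro mult_left_mono) auto
  then show ?thesis by (simp add: potential_def algebra_simps)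
qed

text \<open>Below the line, raising it lowers the \<open>min\<close> term by
  \<open>(1 - 2 * e)^2 * e\<close>, and the sum adds a drop of \<open>e * threshold e k\<close>. The
  charge \<open>e * (1 - p)\<close> supplies the remaining
  \<open>e * (1 - threshold e k)\<close>.\<close>

lemma cost_ge_potential_up:
  assumes "0 \<le> e" "e \<le> 1 / 2" "p < threshold e k"
  shows "e * (1 - q) + max 0 (q - p)
           \<ge> (1 + (1 - 2 * e)\<^sup>2) * e + potential e (Suc k) q - potential e k p"
proof -
  have "threshold e k \<le> threshold e (Suc k)"
    using assms by (simp add: threshold_Suc)
  then have "potential e (Suc k) p - potential e k p
      = - ((1 - 2 * e)\<^sup>2 * e) - e * threshold e k"
    using assms(3) by (simp add: potential_def threshold_Suc algebra_simps power2_eq_square)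
  moreover have "e * p \<le> e * threshold e k"
    using assms by (intro mult_left_mono) auto
  moreover have "e * (q - p) \<le> e * max 0 (q - p)"
    using assms by (intro mult_left_mono) auto
  ultimately show ?thesis
    using potential_move[OF assms(2), of "Suc k" q p] by (simp add: algebra_simps)
qed

text \<open>Above the line the \<open>min\<close> term vanishes, and the charge \<open>e * p\<close>
  repays the removed summand.\<close>

lemma cost_ge_potential_down:
  assumes "0 \<le> e" "e \<le> 1 / 2" "threshold e (Suc k) \<le> p"
  shows "e * q + max 0 (q - p) \<ge> potential e k q - potential e (Suc k) p"
proof -
  have mono: "threshold e k \<le> threshold e (Suc k)"
    using assms by (simp add: threshold_Suc)
  then have "potential e k p - potential e (Suc k) p = e * threshold e k"
    using assms(3) by (simp add: potential_def algebra_simps)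
  moreover have "e * threshold e k \<le> e * p"
    using assms mono by (intro mult_left_mono) auto
  moreover have "0 \<le> e * max 0 (q - p)"
    using assms by simp
  ultimately show ?thesis
    using potential_move[OF assms(2), of k q p] by (simp add: algebra_simps)
qed

lemma cost_ge_potential_top:
  assumes "0 \<le> e" "e \<le> 1 / 2" "p \<le> 1 - e"
  shows "e * (1 - q) + max 0 (q - p) \<ge> e\<^sup>2 + potential e k q - potential e k p"
proof -
  have "e * e \<le> e * (1 - p)"
    using assms by (intro mult_left_mono) auto
  moreover have "e * (q - p) \<le> e * max 0 (q - p)"
    using assms by (intro mult_left_mono) auto
  ultimately show ?thesis
    using potential_move[OF assms(2), of k q p] by (simp add: algebra_simps power2_eq_square)
qed

lemma cost_ge_potential_bottom:
  assumes "0 \<le> e" "e \<le> 1 / 2" "e \<le> p"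
  shows "e * q + max 0 (q - p) \<ge> e\<^sup>2 + potential e k q - potential e k p"
proof -
  have "e * e \<le> e * p"
    using assms by (intro mult_left_mono) auto
  moreover have "0 \<le> e * max 0 (q - p)"
    using assms by simp
  ultimately show ?thesis
    using potential_move[OF assms(2), of k q p] by (simp add: algebra_simps power2_eq_square)
qed

text \<open>This bound is uniform in \<open>k\<close> and \<open>p\<close>, hence an additive
  constant independent of time.\<close>

lemma potential_ge:
  assumes "0 \<le> e" "e \<le> 1 / 2" "e * real k \<le> 1" "0 \<le> p"
  shows "potential e k p \<ge> - 2"
proof -
  have "e * real j \<le> 1" if "j < k" for j
    using that assms(1,3) by (meson less_imp_le mult_left_mono of_nat_le_iff order_trans)
  then have "(\<Sum>j<k. threshold e j) \<le> (\<Sum>j<k. 1)"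
    using assms threshold_bounds(2) by (intro sum_mono) (smt (verit) lessThan_iff)
  then have "e * (\<Sum>j<k. threshold e j) \<le> e * real k"
    using assms by (intro mult_left_mono) auto
  then have sum: "e * (\<Sum>j<k. threshold e j) \<le> 1"
    using assms(3) by linarith
  define y where "y = min 0 (p - threshold e k)"
  have "- 1 \<le> (1 - 2 * e) * (-1)"
    using assms(1) by simp
  also have "\<dots> \<le> (1 - 2 * e) * y"
    using assms threshold_bounds(2)[OF assms(1-3)] unfolding y_def by (intro mult_left_mono) auto
  finally have "- 1 \<le> (1 - 2 * e) * y" .
  moreover have "0 \<le> e * p" using assms by simp
  ultimately have "- 2 \<le> e * p + (1 - 2 * e) * y - 1"
    by linarith
  also have "\<dots> \<le> potential e k p"
    using sum by (simp add: potential_def y_def)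
  finally show ?thesis .
qed

section \<open>The adversary\<close>

text \<open>
  \<open>P fs\<close> is the probability of being in state 1 after the tasks \<open>fs\<close>. The components of the state
  are the tasks so far, the counter \<open>k\<close>, the number of increments of \<open>k\<close>, and the
  number of truncated steps.
\<close>

primrec adversary ::
    "nat \<Rightarrow> ((nat \<Rightarrow> real) list \<Rightarrow> real) \<Rightarrow> nat \<Rightarrow> (nat \<Rightarrow> real) list \<times> nat \<times> nat \<times> nat" where
  "adversary n P 0 = ([], 0, 0, 0)"
| "adversary n P (Suc t) = (case adversary n P t of (fs, k, U, S) \<Rightarrow>
     if P fs < threshold (1 / real n) k
     then (fs @ [two_state_cost (1 / real n) 0], if k < n then (Suc k, Suc U, S) else (k, U, Suc S))
     else (fs @ [two_state_cost 0 (1 / real n)], if k > 0 then (k - 1, U, S) else (k, U, Suc S)))"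

text \<open>The tasks depend only on \<open>P\<close>, not on random outcomes, so the instance is
  fixed in advance. At time 0 this is \<open>last []\<close>, which enters no cost.\<close>

definition adversary_cost :: "nat \<Rightarrow> ((nat \<Rightarrow> real) list \<Rightarrow> real) \<Rightarrow> nat \<Rightarrow> nat \<Rightarrow> real" where
  "adversary_cost n P t = last (fst (adversary n P t))"

lemma map_adversary_cost: "map (adversary_cost n P) [1..<Suc t] = fst (adversary n P t)"
proof (induction t)
  case (Suc t)
  have "fst (adversary n P (Suc t)) = fst (adversary n P t) @ [adversary_cost n P (Suc t)]"
    by (auto simp: adversary_cost_def split: prod.splits)
  then show ?case using Suc by simp
qed simp

lemma adversary_cost_in_cost_functions: "adversary_cost n P (Suc t) \<in> cost_functions 1"
  by (auto simp: adversary_cost_def split: prod.splits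
      intro!: two_state_cost_in_cost_functions[unfolded One_nat_def])

definition fractional_cost :: "nat \<Rightarrow> (nat \<Rightarrow> nat \<Rightarrow> real) \<Rightarrow> (nat \<Rightarrow> real) \<Rightarrow> real" where
  "fractional_cost T f p =
     (\<Sum>t=1..T. f t 0 * (1 - p t) + f t 1 * p t + max 0 (p t - p (t - 1)))"

text \<open>With \<open>D\<close> decrements, \<open>t = U + D + S\<close> and
  \<open>k = U - D\<close>, which gives the counting identity. The cost bound sums the four one-step
  inequalities.\<close>

lemma adversary_invariant:
  fixes P n
  defines "e \<equiv> 1 / real n" and "f \<equiv> adversary_cost n P"
    and "p \<equiv> \<lambda>t. P (fst (adversary n P t))"
  assumes n: "n \<ge> 2" and P0: "P [] = 0"
    and "adversary n P t = (fs, k, U, S)"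
  shows "k \<le> n \<and> t + k = 2 * U + S
    \<and> work_bound t f 0 (e * real U) \<and> work_bound t f 1 (e * real U + 1 - e * real k)
    \<and> fractional_cost t f p
        \<ge> (1 + (1 - 2 * e)\<^sup>2) * (e * real U) + e\<^sup>2 * real S + potential e k (P fs)"
  using assms(6)
proof (induction t arbitrary: fs k U S)
  case 0
  have "(\<lambda>t\<in>{0..0}. 0) \<in> schedules 0 1" by (auto simp: schedules_def)
  then have "work_bound 0 f 0 0" "work_bound 0 f 1 1"
    by (auto simp: work_bound_def schedule_cost_0 intro!: bexI[of _ "\<lambda>t\<in>{0..0}. 0"])
  moreover have "e \<le> 1 / 2" "e \<ge> 0" using n by (auto simp: e_def field_simps)
  then have "potential e 0 0 \<le> 0"
    by (auto simp: potential_def threshold_def mult_nonneg_nonpos)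
  ultimately show ?case using 0 P0 by (auto simp: fractional_cost_def)
next
  case (Suc t)
  obtain fs0 k0 U0 S0 where prev: "adversary n P t = (fs0, k0, U0, S0)"
    by (metis prod_cases4)
  note IH = Suc.IH[OF prev]
  have e: "0 \<le> e" "e \<le> 1 / 2" "e * real n = 1" using n by (auto simp: e_def field_simps)
  have ek: "e * real k0 \<le> 1"
    using conjunct1[OF IH] n by (simp add: e_def field_simps)
  note thr = threshold_bounds[OF e(1,2) ek]
  have pt: "p t = P fs0" "p (Suc t) = P fs"
    using prev Suc.prems by (simp_all add: p_def del: adversary.simps)
  have cost: "fractional_cost (Suc t) f p = fractional_cost t f p
      + (f (Suc t) 0 * (1 - P fs) + f (Suc t) 1 * P fs + max 0 (P fs - P fs0))"
    by (simp add: fractional_cost_def pt)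
  have fSuc: "f (Suc t) = last fs"
    using Suc.prems by (simp add: f_def adversary_cost_def del: adversary.simps)
  have wb: "work_bound t f 0 (e * real U0)" "work_bound t f (Suc 0) (e * real U0 + 1 - e * real k0)"
    using IH by auto
  have rec: "(fs, k, U, S) =
      (if P fs0 < threshold e k0
       then (fs0 @ [two_state_cost e 0], if k0 < n then (Suc k0, Suc U0, S0) else (k0, U0, Suc S0))
       else (fs0 @ [two_state_cost 0 e], if k0 > 0 then (k0 - 1, U0, S0) else (k0, U0, Suc S0)))"
    using Suc.prems unfolding adversary.simps prev e_def by simp
  have kn: "k0 \<le> n"
    and lower: "fractional_cost t f p
      \<ge> (1 + (1 - 2 * e)\<^sup>2) * (e * real U0) + e\<^sup>2 * real S0 + potential e k0 (P fs0)"
    using IH by blast+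
  \<comment> \<open>Offline schedules that serve the new task in state 0 or in state 1,
    respectively.\<close>
  note step0 = work_bound_Suc[OF wb(1)] and step1 = work_bound_Suc[OF wb(2)]
  consider
      (up) "P fs0 < threshold e k0" "k0 < n" "fs = fs0 @ [two_state_cost e 0]"
        "k = Suc k0" "U = Suc U0" "S = S0"
    | (top) "P fs0 < threshold e k0" "k0 = n" "fs = fs0 @ [two_state_cost e 0]"
        "k = k0" "U = U0" "S = Suc S0"
    | (down) "threshold e k0 \<le> P fs0" "k0 > 0" "fs = fs0 @ [two_state_cost 0 e]"
        "k = k0 - 1" "U = U0" "S = S0"
    | (bottom) "threshold e k0 \<le> P fs0" "k0 = 0" "fs = fs0 @ [two_state_cost 0 e]"
        "k = k0" "U = U0" "S = Suc S0"
  proof (cases "P fs0 < threshold e k0")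
    case True
    then show ?thesis using rec kn up top by (cases "k0 < n") simp_all
  next
    case False
    then show ?thesis using rec down bottom by (cases "k0 > 0") simp_all
  qed
  then show ?case
  proof cases
    case up
    have f: "f (Suc t) = two_state_cost e 0" using fSuc up by simp
    have "work_bound (Suc t) f 0 (e * real U)"
      by (rule step0) (auto simp: f up algebra_simps)
    moreover have "work_bound (Suc t) f 1 (e * real U + 1 - e * real k)"
      by (rule step1) (auto simp: f up algebra_simps)
    moreover have "fractional_cost (Suc t) f p
        \<ge> (1 + (1 - 2 * e)\<^sup>2) * (e * real U) + e\<^sup>2 * real S + potential e k (P fs)"
      using lower cost_ge_potential_up[OF e(1,2) up(1), of "P fs"]
      by (simp add: cost f up algebra_simps)
    ultimately show ?thesis using IH up by auto
  next
    case top
    have f: "f (Suc t) = two_state_cost e 0" using fSuc top by simp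
    \<comment> \<open>As \<open>e * real n = 1\<close>, being in state 1 is no dearer; serving there
      and then dropping to 0 for free avoids the charge.\<close>
    have "work_bound (Suc t) f 0 (e * real U)"
      by (rule step1) (auto simp: f top e)
    moreover have "work_bound (Suc t) f 1 (e * real U + 1 - e * real k)"
      by (rule step1) (auto simp: f top e)
    moreover have "P fs0 \<le> 1 - e" using thr top by linarith
    from cost_ge_potential_top[OF e(1,2) this, of k "P fs"]
    have "fractional_cost (Suc t) f p
        \<ge> (1 + (1 - 2 * e)\<^sup>2) * (e * real U) + e\<^sup>2 * real S + potential e k (P fs)"
      using lower by (simp add: cost f top algebra_simps)
    ultimately show ?thesis using IH top by auto
  next
    case down
    have f: "f (Suc t) = two_state_cost 0 e" using fSuc down by simp
    have k0: "k0 = Suc k" using down by simp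
    have "work_bound (Suc t) f 0 (e * real U)"
      by (rule step0) (auto simp: f down)
    moreover have "work_bound (Suc t) f 1 (e * real U + 1 - e * real k)"
      by (rule step1) (auto simp: f k0 down(5) algebra_simps)
    moreover have "fractional_cost (Suc t) f p
        \<ge> (1 + (1 - 2 * e)\<^sup>2) * (e * real U) + e\<^sup>2 * real S + potential e k (P fs)"
      using lower cost_ge_potential_down[OF e(1,2) down(1)[unfolded k0], of "P fs"]
      by (simp add: cost f k0 down(5,6) algebra_simps)
    ultimately show ?thesis using IH k0 down(5,6) by auto
  next
    case bottom
    have f: "f (Suc t) = two_state_cost 0 e" using fSuc bottom by simp
    have "work_bound (Suc t) f 0 (e * real U)"
      by (rule step0) (auto simp: f bottom)
    \<comment> \<open>Serve for free in state 0 and switch up afterwards, at cost 1.\<close>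
    moreover have "work_bound (Suc t) f 1 (e * real U + 1 - e * real k)"
      by (rule step0) (auto simp: f bottom)
    moreover have "e \<le> P fs0" using thr bottom by linarith
    from cost_ge_potential_bottom[OF e(1,2) this, of k "P fs"]
    have "fractional_cost (Suc t) f p
        \<ge> (1 + (1 - 2 * e)\<^sup>2) * (e * real U) + e\<^sup>2 * real S + potential e k (P fs)"
      using lower by (simp add: cost f bottom algebra_simps)
    ultimately show ?thesis using IH bottom by auto
  qed
qed

section \<open>From randomized to fractional algorithms\<close>

text \<open>Every function on two states is affine, so expected operating costs depend only on the
  probabilities; for switching costs, Jensen's inequality applies to the positive part.\<close>

lemma expected_cost_ge_fractional_cost:
  assumes A: "randomized_online_algorithm M A"
    and f: "\<And>t. f (Suc t) \<in> cost_functions 1"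
  shows "fractional_cost T f (\<lambda>t. \<integral>\<omega>. real (alg_schedule A 1 1 f \<omega> t) \<partial>M) \<le> expected_cost M A T 1 1 f"
    and "0 \<le> (\<integral>\<omega>. real (alg_schedule A 1 1 f \<omega> t) \<partial>M)"
proof -
  interpret prob_space M using A by (simp add: randomized_online_algorithm_def)
  define X where "X t \<omega> = alg_schedule A 1 1 f \<omega> t" for t \<omega>
  have X_meas: "X t \<in> M \<rightarrow>\<^sub>M count_space {0..1}" for t
  proof (cases t)
    case 0
    then have "X t = (\<lambda>_. 0)" by (auto simp: X_def alg_schedule_def)
    then show ?thesis by simp
  next
    case (Suc s)
    have "f i \<in> cost_functions 1" if "i \<ge> 1" for i
      using f[of "i - 1"] that by simp
    then have "set (map f [1..<Suc t]) \<subseteq> cost_functions 1" "map f [1..<Suc t] \<noteq> []"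
      using Suc by auto
    then have "A 1 1 (map f [1..<Suc t]) \<in> M \<rightarrow>\<^sub>M count_space {0..1}"
      using A unfolding randomized_online_algorithm_def by (meson zero_less_one)
    then show ?thesis using Suc by (simp add: X_def alg_schedule_def cong: measurable_cong)
  qed
  have X_range: "X t \<omega> \<in> {0..1}" if "\<omega> \<in> space M" for t \<omega>
    using measurable_space[OF X_meas that] by simp
  have [measurable]: "(\<lambda>\<omega>. real (X t \<omega>)) \<in> borel_measurable M" for t
    using measurable_compose[OF X_meas, of real borel] by simp
  have int: "integrable M (\<lambda>\<omega>. real (X t \<omega>))" for t
    by (rule integrable_const_bound[where B = 1]) (use X_range in auto)
  have int_max: "integrable M (\<lambda>\<omega>. max 0 (real (X s \<omega>) - real (X t \<omega>)))" for s t
    using int by auto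
  define p where "p t = (\<integral>\<omega>. real (X t \<omega>) \<partial>M)" for t
  have max_le: "max 0 (p s - p t) \<le> (\<integral>\<omega>. max 0 (real (X s \<omega>) - real (X t \<omega>)) \<partial>M)" for s t
  proof -
    have "p s - p t = (\<integral>\<omega>. real (X s \<omega>) - real (X t \<omega>) \<partial>M)"
      unfolding p_def using int by (simp add: Bochner_Integration.integral_diff)
    also have "\<dots> \<le> (\<integral>\<omega>. max 0 (real (X s \<omega>) - real (X t \<omega>)) \<partial>M)"
      using int int_max by (intro integral_mono) auto
    finally show ?thesis by (simp add: integral_nonneg_AE)
  qed
  have affine: "f t (X t \<omega>) = f t 0 + (f t 1 - f t 0) * real (X t \<omega>)" if "\<omega> \<in> space M" for t \<omega>
  proof -
    have "X t \<omega> = 0 \<or> X t \<omega> = 1" using X_range[OF that, of t] by auto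
    then show ?thesis by auto
  qed
  have "expected_cost M A T 1 1 f = (\<integral>\<omega>. (\<Sum>t=1..T. f t 0 + (f t 1 - f t 0) * real (X t \<omega>)
      + max 0 (real (X t \<omega>) - real (X (t - 1) \<omega>))) \<partial>M)"
    unfolding expected_cost_def schedule_cost_def
    by (intro Bochner_Integration.integral_cong)
      (auto simp flip: X_def simp: affine sum.distrib simp del: One_nat_def)
  also have "\<dots> = (\<Sum>t=1..T. f t 0 + (f t 1 - f t 0) * p t
      + (\<integral>\<omega>. max 0 (real (X t \<omega>) - real (X (t - 1) \<omega>)) \<partial>M))"
    using int int_max by (simp add: p_def prob_space)
  also have "\<dots> \<ge> fractional_cost T f p"
    unfolding fractional_cost_def by (intro sum_mono) (use max_le in \<open>simp add: algebra_simps\<close>)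
  finally show "fractional_cost T f (\<lambda>t. \<integral>\<omega>. real (alg_schedule A 1 1 f \<omega> t) \<partial>M)
      \<le> expected_cost M A T 1 1 f"
    by (simp add: p_def X_def)
  show "0 \<le> (\<integral>\<omega>. real (alg_schedule A 1 1 f \<omega> t) \<partial>M)" by (simp add: integral_nonneg_AE)
qed

section \<open>The long-run ratio on the adversary's instances\<close>

theorem theorem5p9:
  "\<not> (\<exists>(M :: 'w measure) A c.
        randomized_online_algorithm M A \<and> has_competitive_ratio M A c \<and> c < 2)"
proof
  assume "\<exists>(M :: 'w measure) A c.
        randomized_online_algorithm M A \<and> has_competitive_ratio M A c \<and> c < 2"
  then obtain M :: "'w measure" and A c where A: "randomized_online_algorithm M A"
    and ratio: "has_competitive_ratio M A c" and c: "c < 2" by blast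
  \<comment> \<open>A large \<open>n\<close> leaves a gap above \<open>c\<close>. Using
    \<open>max c 1\<close> keeps the factor nonnegative, so that upper bounds on the optimum can be
    multiplied by it.\<close>
  have "(\<lambda>n. 1 + (1 - 2 * (1 / real n))\<^sup>2) \<longlonglongrightarrow> 1 + (1 - 2 * 0)\<^sup>2"
    by (intro tendsto_intros lim_1_over_n)
  then have "eventually (\<lambda>n. max c 1 < 1 + (1 - 2 * (1 / real n))\<^sup>2) sequentially"
    using c by (intro order_tendstoD(1)) auto
  with eventually_ge_at_top[of 2]
  have "eventually (\<lambda>n. n \<ge> 2 \<and> max c 1 < 1 + (1 - 2 * (1 / real n))\<^sup>2) sequentially"
    by eventually_elim auto
  then obtain n :: nat where n: "n \<ge> 2" and gap: "max c 1 < 1 + (1 - 2 * (1 / real n))\<^sup>2"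
    by (auto dest: eventually_happens)
  define e where "e = 1 / real n"
  have e: "0 < e" "e \<le> 1 / 2" using n by (auto simp: e_def field_simps)
  \<comment> \<open>The value 0 at \<open>[]\<close> encodes the initial state; \<open>A\<close> is
    queried only on nonempty prefixes.\<close>
  define P where "P fs = (if fs = [] then 0 else \<integral>\<omega>. real (A 1 1 fs \<omega>) \<partial>M)" for fs
  define f where "f = adversary_cost n P"
  have f: "f (Suc t) \<in> cost_functions 1" for t
    unfolding f_def by (rule adversary_cost_in_cost_functions)
  have p: "P (fst (adversary n P t)) = (\<integral>\<omega>. real (alg_schedule A 1 1 f \<omega> t) \<partial>M)" for t
    unfolding map_adversary_cost[symmetric] by (auto simp: P_def alg_schedule_def f_def)
  define gain where "gain = 1 + (1 - 2 * e)\<^sup>2 - max c 1"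
  \<comment> \<open>The ratio bounds \<open>gain * e * real U + e^2 * real S\<close> by 2, while
    \<open>t\<close> is at most \<open>2 * U + S\<close>; hence the halved first weight. For large
    \<open>t\<close> this fails.\<close>
  have bound: "min (gain * e / 2) (e\<^sup>2) * real t \<le> 2" for t
  proof -
    obtain fs k U S where adv: "adversary n P t = (fs, k, U, S)" by (metis prod_cases4)
    have "P [] = 0" by (simp add: P_def)
    from adversary_invariant[OF n this adv, folded e_def f_def]
    have kn: "k \<le> n" and count: "t + k = 2 * U + S"
      and wb: "work_bound t f 0 (e * real U)"
      and lower: "(1 + (1 - 2 * e)\<^sup>2) * (e * real U) + e\<^sup>2 * real S + potential e k (P fs)
        \<le> fractional_cost t f (\<lambda>t. P (fst (adversary n P t)))"
      by blast+
    have inst: "dc_instance t 1 1 f"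
      using f unfolding dc_instance_def by (auto simp: Suc_le_eq gr0_conv_Suc)
    have "P fs \<ge> 0"
      using expected_cost_ge_fractional_cost(2)[of M A f t, OF A f] p[of t] adv by simp
    moreover have "e * real k \<le> 1" using kn n by (simp add: e_def field_simps)
    ultimately have pot: "potential e k (P fs) \<ge> - 2"
      using e by (intro potential_ge) auto
    have "fractional_cost t f (\<lambda>t. P (fst (adversary n P t))) \<le> expected_cost M A t 1 1 f"
      using expected_cost_ge_fractional_cost(1)[of M A f t, OF A f] by (simp add: p)
    also have "\<dots> \<le> c * opt_cost t 1 1 f"
      using ratio inst by (auto simp: has_competitive_ratio_def)
    also have "\<dots> \<le> max c 1 * opt_cost t 1 1 f"
      using opt_cost_nonneg[OF inst] by (intro mult_right_mono) auto
    also have "\<dots> \<le> max c 1 * (e * real U)"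
      using opt_cost_le_work_bound[OF wb] by (intro mult_left_mono) auto
    finally have main: "gain * e * real U + e\<^sup>2 * real S \<le> 2"
      using lower pot by (simp add: gain_def algebra_simps)
    have "real t \<le> 2 * real U + real S" using count by linarith
    moreover have "min (gain * e / 2) (e\<^sup>2) \<ge> 0"
      using gap e by (auto simp: gain_def e_def)
    ultimately have "min (gain * e / 2) (e\<^sup>2) * real t
        \<le> min (gain * e / 2) (e\<^sup>2) * (2 * real U + real S)"
      by (intro mult_left_mono)
    also have "\<dots> = min (gain * e / 2) (e\<^sup>2) * (2 * real U) + min (gain * e / 2) (e\<^sup>2) * real S"
      by (simp add: algebra_simps)
    also have "\<dots> \<le> gain * e / 2 * (2 * real U) + e\<^sup>2 * real S"
      by (intro add_mono mult_right_mono) auto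
    also have "\<dots> \<le> 2" using main by simp
    finally show ?thesis .
  qed
  have "min (gain * e / 2) (e\<^sup>2) > 0"
    using gap e by (auto simp: gain_def e_def)
  then obtain t where "2 < real t * min (gain * e / 2) (e\<^sup>2)"
    using reals_Archimedean3 by blast
  with bound[of t] show False by (simp add: mult.commute)
qed

end
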